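(* Let $\theta\in(0,1)$ be irrational and $\sigma:x\mapsto x+\theta$ on $\mathbb{T}=\mathbb{R}/\mathbb{Z}$. Let $\nu$ be the probability measure on $\mathbb{T}$ constructed, as described in the context, from an increasing sequence $(m_i)_{i\ge1}$ in $\mathbb{N}$ with $|(m_1\theta)|<1/3$ and $|(m_i\theta)|<|(m_{i-1}\theta)|/3$ for $i>1$, and a sequence $(a_i)_{i\ge1}$ in $(0,1)$ with $\inf_i a_i>0$ and $\sup_i a_i<1$. Then $\nu$ is an ergodic $\sigma$-quasi-invariant singular continuous measure on $\mathbb{T}$.
   Context: For $x\in\mathbb{R}$, $(x)$ denotes the representative in $(-1/2,1/2]$ of $x+\mathbb{Z}$. Let $P=\prod_{i=1}^\infty\{0,1\}$ with the product topology and define $\Phi:P\to\mathbb{T}$ by $\Phi(x)=\sum_{i=1}^\infty x_i(m_i\theta)$ (mod $\mathbb{Z}$) for $x=(x_i)$; $\Phi$ is a homeomorphism of $P$ onto the compact set $\Phi(P)$. Let $\nu_0$ be the product measure on $P$ whose $i$-th factor gives mass $a_i$ to $0$ and $1-a_i$ to $1$. Define a probability measure $\nu_0'$ on $\mathbb{T}$ by $\nu_0'(A)=\nu_0(\Phi^{-1}(A\cap\Phi(P)))$ and then, with $\gamma=\sqrt2-1$, define $$\nu(A)=\sum_{k=-\infty}^{\infty}\gamma^{1+|k|}\nu_0'(\sigma^k(A))$$ for Borel sets $A\subset\mathbb{T}$; this is a probability measure. A probability measure is $\sigma$-quasi-invariant if it has the same null sets as its image under $\sigma$, ergodic if every $\sigma$-invariant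 Borel set has measure $0$ or $1$, and singular continuous if it is non-atomic and singular with respect to the Lebesgue measure. *)

theory Defs
  imports "HOL-Probability.Probability"
begin

quotient_type circle = real / "\<lambda>x y :: real. x - y \<in> \<int>"
proof (rule equivpI)
  show "reflp (\<lambda>x y :: real. x - y \<in> \<int>)"
    by (simp add: reflp_def)
  show "symp (\<lambda>x y :: real. x - y \<in> \<int>)"
    by (metis (no_types, lifting) Ints_minus minus_diff_eq sympI)
  show "transp (\<lambda>x y :: real. x - y \<in> \<int>)"
    by (rule transpI) (metis Ints_add diff_add_cancel add_diff_eq)
qed

lift_definition to_circle :: "real \<Rightarrow> circle" is "\<lambda>x. x" .

instantiation circle :: ab_group_add
begin

lift_definition zero_circle :: circle is 0 .

lift_definition plus_circle :: "circle \<Rightarrow> circle \<Rightarrow> circle" is "(+)"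
  by (metis Ints_add add_diff_add)

lift_definition uminus_circle :: "circle \<Rightarrow> circle" is uminus
  by (metis Ints_minus minus_diff_minus)

lift_definition minus_circle :: "circle \<Rightarrow> circle \<Rightarrow> circle" is "(-)"
  by (metis Ints_diff diff_diff_eq diff_diff_eq2 add.commute diff_add_eq)

instance
  by standard (transfer, simp add: algebra_simps)+

end

instantiation circle :: topological_space
begin

definition open_circle :: "circle set \<Rightarrow> bool"
  where "open_circle U \<longleftrightarrow> open (to_circle -` U)"

instance
  by standard (auto simp: open_circle_def vimage_Union)

end

definition lebesgue_circle :: "circle measure"
  where "lebesgue_circle = distr (restrict_space lborel {0..<1}) borel to_circle"

definition rotation :: "real \<Rightarrow> circle \<Rightarrow> circle"
  where "rotation \<theta> x = x + to_circle \<theta>"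

definition signed_rep :: "real \<Rightarrow> real"
  where "signed_rep x = x - of_int \<lceil>x - 1/2\<rceil>"

lemma signed_rep_unique:
  "signed_rep x = r \<longleftrightarrow> r \<in> {-1/2<..1/2} \<and> x - r \<in> \<int>"
proof
  assume "signed_rep x = r"
  then show "r \<in> {-1/2<..1/2} \<and> x - r \<in> \<int>"
    unfolding signed_rep_def by (auto; linarith)
next
  assume r: "r \<in> {-1/2<..1/2} \<and> x - r \<in> \<int>"
  then obtain k where "x = r + of_int k"
    by (metis Ints_cases diff_eq_eq add.commute)
  moreover from this r have "\<lceil>x - 1/2\<rceil> = k"
    by (intro ceiling_unique) auto
  ultimately show "signed_rep x = r"
    by (simp add: signed_rep_def)
qed

text \<open>The power \<open>f\<^sup>k\<close> for \<open>k \<in> \<int>\<close>; meaningful only for bijective \<open>f\<close>.\<close>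

definition int_iterate :: "('a \<Rightarrow> 'a) \<Rightarrow> int \<Rightarrow> 'a \<Rightarrow> 'a"
  where "int_iterate f k = (if 0 \<le> k then f ^^ nat k else inv f ^^ nat (- k))"

definition quasi_invariant :: "('a \<Rightarrow> 'a) \<Rightarrow> 'a measure \<Rightarrow> bool"
  where "quasi_invariant T M \<longleftrightarrow> null_sets M = null_sets (distr M M T)"

definition ergodic :: "('a \<Rightarrow> 'a) \<Rightarrow> 'a measure \<Rightarrow> bool"
  where "ergodic T M \<longleftrightarrow>
    (\<forall>A\<in>sets M. T -` A \<inter> space M = A \<longrightarrow> emeasure M A = 0 \<or> emeasure M A = 1)"

definition atom :: "'a measure \<Rightarrow> 'a set \<Rightarrow> bool"
  where "atom M A \<longleftrightarrow> A \<in> sets M \<and> 0 < emeasure M A \<and>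
    (\<forall>B\<in>sets M. B \<subseteq> A \<longrightarrow> emeasure M B = 0 \<or> emeasure M (A - B) = 0)"

definition nonatomic :: "'a measure \<Rightarrow> bool"
  where "nonatomic M \<longleftrightarrow> (\<nexists>A. atom M A)"

definition mutually_singular :: "'a measure \<Rightarrow> 'a measure \<Rightarrow> bool"
  where "mutually_singular M N \<longleftrightarrow>
    (\<exists>A \<in> sets M \<inter> sets N. emeasure M A = 0 \<and> emeasure N (space N - A) = 0)"

definition singular_continuous :: "circle measure \<Rightarrow> bool"
  where "singular_continuous M \<longleftrightarrow> nonatomic M \<and> mutually_singular M lebesgue_circle"

text \<open>Sequences are indexed from \<open>0\<close>, so \<open>m i\<close> and \<open>a i\<close> stand for \<open>m\<^sub>i\<^sub>+\<^sub>1\<close> and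
  \<open>a\<^sub>i\<^sub>+\<^sub>1\<close>. The product \<open>\<Prod>\<^sub>i {0,1}\<close> is the type \<open>nat \<Rightarrow> bool\<close>, with \<open>False\<close> for \<open>0\<close> and
  \<open>True\<close> for \<open>1\<close>.\<close>

definition digit_map :: "real \<Rightarrow> (nat \<Rightarrow> nat) \<Rightarrow> (nat \<Rightarrow> bool) \<Rightarrow> circle"
  where "digit_map \<theta> m x = to_circle (\<Sum>i. of_bool (x i) * signed_rep (real (m i) * \<theta>))"

text \<open>The parameter of \<open>bernoulli_pmf\<close> is the mass of \<open>True\<close>.\<close>

definition digit_measure :: "(nat \<Rightarrow> real) \<Rightarrow> (nat \<Rightarrow> bool) measure"
  where "digit_measure a = PiM UNIV (\<lambda>i. measure_pmf (bernoulli_pmf (1 - a i)))"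

definition circle_digit_measure :: "real \<Rightarrow> (nat \<Rightarrow> nat) \<Rightarrow> (nat \<Rightarrow> real) \<Rightarrow> circle measure"
  where "circle_digit_measure \<theta> m a = distr (digit_measure a) borel (digit_map \<theta> m)"

definition orbit_measure :: "real \<Rightarrow> (nat \<Rightarrow> nat) \<Rightarrow> (nat \<Rightarrow> real) \<Rightarrow> circle measure"
  where "orbit_measure \<theta> m a = measure_of UNIV (sets borel)
    (\<lambda>A. \<Sum>\<^sub>\<infinity>k::int. ennreal ((sqrt 2 - 1) ^ (1 + nat \<bar>k\<bar>)) *
      emeasure (circle_digit_measure \<theta> m a) (int_iterate (rotation \<theta>) k ` A))"

end

theory Submission
  imports Defs
begin

text \<open>
  Writing \<open>b\<^sub>i\<close> for the signed representative of \<open>m\<^sub>i\<theta>\<close>, the condition \<open>\<bar>b\<^sub>i\<^sub>+\<^sub>1\<bar> < \<bar>b\<^sub>i\<bar> / 3\<close> makes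
  \<open>x \<mapsto> \<Sum>\<^sub>i x\<^sub>i b\<^sub>i\<close> injective modulo \<open>1\<close>, since each nonzero digit outweighs the tail after it, and puts
  its range into a Cantor-like compact set covered by \<open>2\<^sup>n\<close> intervals of length \<open>3\<^sup>-\<^sup>n\<close>. The countably many
  translates of this set along the orbit of \<open>\<theta>\<close> are Lebesgue null and carry \<open>\<nu>\<close>; injectivity leaves \<open>\<nu>\<close>
  without point masses. For ergodicity, a rotation-invariant set \<open>A\<close> has \<open>\<nu>(A) = \<nu>\<^sub>0(\<Phi>\<^sup>-\<^sup>1(A))\<close>, and changing
  finitely many digits of \<open>x\<close> moves \<open>\<Phi>(x)\<close> by an integer multiple of \<open>\<theta>\<close>; so \<open>\<Phi>\<^sup>-\<^sup>1(A)\<close> is a tail event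
  and Kolmogorov's zero-one law applies.
\<close>

section \<open>Measure-theoretic preliminaries\<close>

text \<open>Turns the sum that defines the orbit measure into an integral over counting measure,
  where series can be interchanged and vanishing can be tested termwise. Enumerating the integers by
  \<open>int_decode\<close> reduces both sides to a series over the naturals.\<close>

lemma infsum_int_eq_nn_integral:
  fixes f :: "int \<Rightarrow> ennreal"
  shows "infsum f UNIV = (\<integral>\<^sup>+k. f k \<partial>count_space UNIV)"
proof -
  have *: "infsum g UNIV = (\<Sum>n. g n)" for g :: "nat \<Rightarrow> ennreal"
    by (rule sums_unique[OF has_sum_imp_sums[OF has_sum_infsum]])
       (simp add: nonneg_summable_on_complete)
  have "infsum f UNIV = infsum (\<lambda>n. f (int_decode n)) UNIV"
    by (rule infsum_reindex_bij_betw[OF bij_int_decode, symmetric])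
  also have "\<dots> = (\<integral>\<^sup>+n. f (int_decode n) \<partial>count_space UNIV)"
    by (simp add: * nn_integral_count_space_nat)
  also have "\<dots> = (\<integral>\<^sup>+k. f k \<partial>count_space UNIV)"
    by (rule nn_integral_bij_count_space[OF bij_int_decode])
  finally show ?thesis .
qed

lemma infsum_two_sided_geometric:
  fixes r :: real
  assumes "0 \<le> r" "r < 1"
  shows "(\<Sum>\<^sub>\<infinity>k::int. ennreal (r ^ (1 + nat \<bar>k\<bar>))) = ennreal (r * (1 + r) / (1 - r))"
proof -
  let ?f = "\<lambda>k::int. ennreal (r ^ (1 + nat \<bar>k\<bar>))"
  have geom: "infsum (\<lambda>n. ennreal (r ^ (j + n))) UNIV = ennreal (r ^ j / (1 - r))" for j
  proof -
    have s: "(\<lambda>n. r ^ (j + n)) sums (r ^ j * (1 / (1 - r)))"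
      unfolding power_add by (intro sums_mult geometric_sums) (use assms in auto)
    have "infsum (\<lambda>n. ennreal (r ^ (j + n))) UNIV = (\<Sum>n. ennreal (r ^ (j + n)))"
      by (rule sums_unique[OF has_sum_imp_sums[OF has_sum_infsum]])
         (simp add: nonneg_summable_on_complete)
    also have "\<dots> = ennreal (\<Sum>n. r ^ (j + n))"
      by (rule suminf_ennreal2) (use s assms in \<open>auto simp: sums_iff\<close>)
    finally show ?thesis using s by (simp add: sums_iff)
  qed
  have "bij_betw int UNIV {0..}"
    by (rule bij_betw_byWitness[where f' = nat]) auto
  from infsum_reindex_bij_betw[OF this, of ?f]
  have pos: "infsum ?f {0..} = ennreal (r / (1 - r))"
    using geom[of 1] by simp
  \<comment> \<open>The negative half begins at k = -1, which already has exponent 2; hence the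
    geometric series with offset 2 rather than 1.\<close>
  have "bij_betw (\<lambda>n. - 1 - int n) UNIV {..<0}"
    by (rule bij_betw_byWitness[where f' = "\<lambda>k. nat (- 1 - k)"]) auto
  moreover have "1 + nat \<bar>- 1 - int n\<bar> = 2 + n" for n
    by simp
  ultimately have neg: "infsum ?f {..<0} = ennreal (r\<^sup>2 / (1 - r))"
    using infsum_reindex_bij_betw[of "\<lambda>n. - 1 - int n" UNIV "{..<0}" ?f] geom[of 2] by simp
  have "infsum ?f UNIV = infsum ?f ({0..} \<union> {..<0})"
    by (rule arg_cong[of _ _ "infsum ?f"]) auto
  also have "\<dots> = infsum ?f {0..} + infsum ?f {..<0}"
    by (rule infsum_Un_disjoint) (auto intro: nonneg_summable_on_complete)
  also have "\<dots> = ennreal (r / (1 - r) + r\<^sup>2 / (1 - r))"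
    unfolding pos neg by (rule ennreal_plus[symmetric]) (use assms in auto)
  also have "r / (1 - r) + r\<^sup>2 / (1 - r) = r * (1 + r) / (1 - r)"
    by (simp add: power2_eq_square distrib_left add_divide_distrib)
  finally show ?thesis .
qed

text \<open>An atom would be split into two halves by the distribution function of \<open>f\<close>, which is continuous.\<close>

lemma nonatomic_if_null_fibres:
  fixes f :: "'a \<Rightarrow> real"
  assumes "finite_measure M" and f: "f \<in> borel_measurable M"
    and fib: "\<And>t. emeasure M (f -` {t} \<inter> space M) = 0"
  shows "nonatomic M"
  unfolding nonatomic_def
proof
  interpret finite_measure M by fact
  assume "\<exists>A. atom M A"
  then obtain A where A: "A \<in> sets M" and pos: "0 < emeasure M A"
    and dich: "\<And>B. B \<in> sets M \<Longrightarrow> B \<subseteq> A \<Longrightarrow> emeasure M B = 0 \<or> emeasure M (A - B) = 0"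
    unfolding atom_def by blast
  have AM: "A \<subseteq> space M" using A by (rule sets.sets_into_space)
  \<comment> \<open>\<open>N\<close> is the law of \<open>f\<close> on the supposed atom: its
    distribution function rises from 0 to the mass \<open>c\<close> of \<open>A\<close>, without
    jumps because fibres are null.\<close>
  define N where "N = distr (restrict_space M A) borel f"
  have f': "f \<in> borel_measurable (restrict_space M A)"
    using f by (rule measurable_restrict_space1)
  have emN: "emeasure N X = emeasure M (f -` X \<inter> A)" if "X \<in> sets borel" for X
    unfolding N_def using that f' A AM
    by (subst emeasure_distr)
       (auto simp: emeasure_restrict_space space_restrict_space Int_absorb1 Int_assoc)
  have mN: "measure N X = measure M (f -` X \<inter> A)" if "X \<in> sets borel" for X
    by (simp add: measure_def emN that)
  have "finite_measure N"
    by (rule finite_measureI) (use emN[of UNIV] in \<open>simp add: N_def\<close>)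
  then interpret N: finite_borel_measure N
    by (rule finite_borel_measure.intro) (simp add: N_def finite_borel_measure_axioms_def)
  define c where "c = measure M A"
  have c: "0 < c" using pos by (simp add: c_def emeasure_eq_measure)
  have "measure N {t} = 0" for t
  proof -
    have "emeasure M (f -` {t} \<inter> A) \<le> emeasure M (f -` {t} \<inter> space M)"
      using AM f by (intro emeasure_mono) (auto intro: measurable_sets)
    then show ?thesis using fib[of t] by (simp add: measure_def emN)
  qed
  then have cont: "isCont (cdf N) t" for t by (simp add: N.isCont_cdf)
  have "(cdf N \<longlongrightarrow> c) at_top"
    using N.cdf_lim_at_top mN[of UNIV] by (simp add: c_def N_def)
  then have "\<forall>\<^sub>F t in at_top. c / 2 < cdf N t"
    by (rule order_tendstoD) (use c in simp)
  then obtain u where u: "c / 2 < cdf N u"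
    by (auto simp: eventually_at_top_linorder)
  have "\<forall>\<^sub>F t in at_bot. cdf N t < c / 2"
    using N.cdf_lim_at_bot by (rule order_tendstoD) (use c in simp)
  then obtain l0 where l0: "\<And>t. t \<le> l0 \<Longrightarrow> cdf N t < c / 2"
    by (auto simp: eventually_at_bot_linorder)
  \<comment> \<open>The minimum gives l \<le> u, as the intermediate value theorem requires, and
    stays in the range where the distribution function is below c / 2.\<close>
  define l where "l = min l0 u"
  have "\<exists>t\<ge>l. t \<le> u \<and> cdf N t = c / 2"
    by (rule IVT) (use u l0[of l] cont in \<open>auto simp: l_def\<close>)
  then obtain t where t: "cdf N t = c / 2" by blast
  define B where "B = f -` {..t} \<inter> A"
  have "B = (f -` {..t} \<inter> space M) \<inter> A" using AM by (auto simp: B_def)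
  then have B: "B \<in> sets M" using f A by (auto intro: measurable_sets)
  have mB: "measure M B = c / 2" using t by (simp add: cdf_def mN B_def)
  have "measure M (A - B) = measure M A - measure M B"
    by (rule finite_measure_Diff) (use A B in \<open>auto simp: B_def\<close>)
  then have "measure M (A - B) = c / 2" by (simp add: mB c_def)
  moreover have "B \<subseteq> A" by (simp add: B_def)
  ultimately show False using dich[OF B] mB c by (simp add: emeasure_eq_measure)
qed

text \<open>Independence means that the joint law is the product of the marginals. Here the joint
  law of the coordinates is the product measure itself and the marginals are its factors.\<close>

lemma indep_vars_PiM_coordinates:
  assumes M: "\<And>i. i \<in> I \<Longrightarrow> prob_space (M i)" and "I \<noteq> {}"
  shows "prob_space.indep_vars (PiM I M) M (\<lambda>i x. x i) I"
proof -
  interpret prob_space "PiM I M" by (rule prob_space_PiM) fact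
  have "distr (PiM I M) (PiM I M) (\<lambda>x. \<lambda>i\<in>I. x i) = distr (PiM I M) (PiM I M) (\<lambda>x. x)"
    by (rule distr_cong) (auto simp: space_PiM)
  also have "\<dots> = PiM I (\<lambda>i. distr (PiM I M) (M i) (\<lambda>x. x i))"
    unfolding distr_id2[OF refl] by (rule PiM_cong) (auto simp: distr_PiM_component M)
  finally show ?thesis
    using \<open>I \<noteq> {}\<close> by (subst indep_vars_iff_distr_eq_PiM') auto
qed

text \<open>Kolmogorov's law with the tail condition replaced by invariance under finite changes,
  which is the property that can be checked directly for preimages under the digit map.\<close>

lemma PiM_zero_one_law:
  fixes M :: "nat \<Rightarrow> 'a measure"
  assumes M: "\<And>i. prob_space (M i)" and X: "X \<in> sets (PiM UNIV M)"
    and inv: "\<And>x y. x \<in> space (PiM UNIV M) \<Longrightarrow> y \<in> space (PiM UNIV M) \<Longrightarrow>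
      finite {i. x i \<noteq> y i} \<Longrightarrow> x \<in> X \<Longrightarrow> y \<in> X"
  shows "emeasure (PiM UNIV M) X = 0 \<or> emeasure (PiM UNIV M) X = 1"
proof -
  let ?P = "PiM UNIV M"
  interpret prob_space ?P by (rule prob_space_PiM) (rule M)
  let ?G = "\<lambda>i. {(\<lambda>x. x i) -` A \<inter> space ?P | A. A \<in> sets (M i)}"
  let ?A = "\<lambda>i. sigma_sets (space ?P) (?G i)"
  have "indep_vars M (\<lambda>i x. x i) UNIV"
    by (rule indep_vars_PiM_coordinates) (auto simp: M)
  then have indep: "indep_sets ?A UNIV" by (simp add: indep_vars_def)
  obtain z where z: "z \<in> space ?P" using not_empty by blast
  \<comment> \<open>\<open>X\<close> is its own preimage under overwriting the first \<open>n\<close> coordinates by those of a fixed point.\<close>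
  have "X \<in> tail_events ?A"
    unfolding tail_events_def
  proof
    fix n
    let ?U = "\<Union> (?A ` {n..})"
    let ?S = "sigma (space ?P) ?U"
    define h where "h x i = (if i < n then z i else x i)" for x i
    have U: "?U \<subseteq> Pow (space ?P)" by (auto dest!: sigma_sets_into_sp[rotated])
    then have sp: "space ?S = space ?P" and st: "sets ?S = sigma_sets (space ?P) ?U"
      by (auto simp: space_measure_of sets_measure_of)
    have hsp: "h x \<in> space ?P" if "x \<in> space ?P" for x
      using that z by (auto simp: h_def space_PiM PiE_iff)
    \<comment> \<open>Coordinates of \<open>h\<close> below \<open>n\<close> are constant; the
      others are generators of the sigma-algebra \<open>?S\<close>.\<close>
    have "h \<in> measurable ?S ?P"
    proof (rule measurable_PiM_single')
      fix i
      show "(\<lambda>x. h x i) \<in> measurable ?S (M i)"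
      proof (rule measurableI)
        fix x assume "x \<in> space ?S"
        then show "h x i \<in> space (M i)"
          using hsp[of x] unfolding sp by (auto simp: space_PiM)
      next
        fix A assume A: "A \<in> sets (M i)"
        show "(\<lambda>x. h x i) -` A \<inter> space ?S \<in> sets ?S"
        proof (cases "i < n")
          case True
          then have "(\<lambda>x. h x i) -` A \<inter> space ?S = (if z i \<in> A then space ?S else {})"
            by (auto simp: h_def)
          then show ?thesis by auto
        next
          case False
          then have "(\<lambda>x. h x i) -` A \<inter> space ?S = (\<lambda>x. x i) -` A \<inter> space ?P"
            by (auto simp: h_def sp)
          also have "\<dots> \<in> ?A i" using A by blast
          finally show ?thesis
            unfolding st using False by (intro sigma_sets.Basic) auto
        qed
      qed
    next
      show "(\<lambda>x i. h x i) \<in> space ?S \<rightarrow> (\<Pi>\<^sub>E i\<in>UNIV. space (M i))"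
        using hsp unfolding sp by (auto simp: space_PiM)
    qed
    then have "h -` X \<inter> space ?S \<in> sets ?S" using X by (rule measurable_sets)
    \<comment> \<open>\<open>h x\<close> and \<open>x\<close> differ only below \<open>n\<close>, so
      the invariance applies in both directions.\<close>
    also have "h -` X \<inter> space ?S = X"
    proof -
      have fin: "finite {i. x i \<noteq> h x i}" for x
        by (rule finite_subset[of _ "{..<n}"]) (auto simp: h_def)
      then have fin': "finite {i. h x i \<noteq> x i}" for x
        by (simp add: eq_commute[of "h x _"])
      have "h x \<in> X \<longleftrightarrow> x \<in> X" if "x \<in> space ?P" for x
        using inv[OF that hsp[OF that] fin] inv[OF hsp[OF that] that fin'] by (rule iffI[rotated])
      then show ?thesis
        using sets.sets_into_space[OF X] unfolding sp by auto
    qed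
    finally show "X \<in> sigma_sets (space ?P) ?U" by (simp add: st)
  qed
  moreover have "sigma_algebra (space ?P) (?A i)" for i
    by (rule sigma_algebra_sigma_sets) auto
  ultimately show ?thesis
    using kolmogorov_0_1_law[OF _ indep] by (auto simp: emeasure_eq_measure)
qed

section \<open>The circle\<close>

lemma to_circle_eq_iff: "to_circle x = to_circle y \<longleftrightarrow> x - y \<in> \<int>"
  by transfer rule

lemma to_circle_add: "to_circle (x + y) = to_circle x + to_circle y"
  by transfer simp

lemma to_circle_minus: "to_circle (- x) = - to_circle x"
  by transfer simp

lemma to_circle_0: "to_circle 0 = 0"
  by transfer simp

lemma to_circle_cases: obtains r where "x = to_circle r"
proof -
  have "\<exists>r. x = to_circle r" by transfer (metis diff_self Ints_0)
  then show ?thesis using that by blast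
qed

lemma measurable_to_circle [measurable]: "to_circle \<in> borel_measurable borel"
  by (intro borel_measurable_continuous_onI, unfold continuous_on_open_vimage[OF open_UNIV])
     (simp add: open_circle_def)

lemma measurable_circle_add [measurable]:
  fixes c :: circle shows "(\<lambda>x. x + c) \<in> borel_measurable borel"
proof (intro borel_measurable_continuous_onI, unfold continuous_on_open_vimage[OF open_UNIV], safe)
  fix U :: "circle set" assume U: "open U"
  obtain r where r: "c = to_circle r" by (rule to_circle_cases)
  have "to_circle -` ((\<lambda>x. x + c) -` U) = (\<lambda>y. y + r) -` (to_circle -` U)"
    by (auto simp: r to_circle_add)
  also have "open \<dots>"
  proof (rule open_vimage)
    show "open (to_circle -` U)" using U by (simp add: open_circle_def)
  qed (intro continuous_intros)
  finally show "open ((\<lambda>x. x + c) -` U \<inter> UNIV)" by (simp add: open_circle_def)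
qed

lemma closed_circle_iff: "closed (A :: circle set) \<longleftrightarrow> closed (to_circle -` A)"
  by (simp add: closed_def open_circle_def vimage_Compl)

lemma vimage_to_circle_image: "to_circle -` (to_circle ` K) = (\<Union>x\<in>K. \<Union>y\<in>\<int>. {x + y})"
  by (force simp: to_circle_eq_iff elim!: image_eqI[rotated])

text \<open>Closedness is tested upstairs in the quotient topology. There the image becomes K + Z,
  the sum of a compact and a closed set.\<close>

lemma closed_to_circle_image:
  assumes "compact K" shows "closed (to_circle ` K)"
  unfolding closed_circle_iff vimage_to_circle_image
  using assms by (intro compact_closed_sums) auto

text \<open>An injective real coordinate, so that the distribution-function argument against atoms
  can be applied to measures on the circle.\<close>

lift_definition circle_rep :: "circle \<Rightarrow> real" is frac
  by (metis Ints_cases add.commute diff_add_cancel frac_add_int_right)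

lemma circle_rep_to_circle: "circle_rep (to_circle x) = frac x"
  by transfer simp

lemma to_circle_rep: "to_circle (circle_rep x) = x"
  by transfer (simp add: frac_def)

text \<open>The coordinate jumps only at the class of 0. For t > 0 its sublevel set is therefore an
  open set together with one closed point.\<close>

lemma measurable_circle_rep [measurable]: "circle_rep \<in> borel_measurable borel"
  unfolding borel_measurable_iff_less
proof
  fix t :: real
  \<comment> \<open>Excluding the value 0 leaves open intervals starting at the integers; the cap at
    1 reflects that fractional parts stay below 1.\<close>
  have "to_circle -` {x. 0 < circle_rep x \<and> circle_rep x < t} =
      (\<Union>n::int. {of_int n<..<of_int n + min t 1})"
  proof (intro set_eqI iffI)
    fix y assume "y \<in> to_circle -` {x. 0 < circle_rep x \<and> circle_rep x < t}"
    then have "y \<in> {of_int \<lfloor>y\<rfloor><..<of_int \<lfloor>y\<rfloor> + min t 1}"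
      using frac_lt_1[of y] by (auto simp: circle_rep_to_circle frac_def)
    then show "y \<in> (\<Union>n::int. {of_int n<..<of_int n + min t 1})" by blast
  next
    fix y assume "y \<in> (\<Union>n::int. {of_int n<..<of_int n + min t 1})"
    then obtain n :: int where n: "of_int n < y" "y < of_int n + min t 1" by auto
    then have "\<lfloor>y\<rfloor> = n" by (intro floor_unique) auto
    with n show "y \<in> to_circle -` {x. 0 < circle_rep x \<and> circle_rep x < t}"
      by (auto simp: circle_rep_to_circle frac_def)
  qed
  then have "open {x. 0 < circle_rep x \<and> circle_rep x < t}"
    unfolding open_circle_def by (simp only:) (intro open_UN; simp)
  moreover have "closed {to_circle 0}"
    using closed_to_circle_image[of "{0}"] by simp
  moreover have "{x \<in> space borel. circle_rep x < t} =
      (if t \<le> 0 then {} else {x. 0 < circle_rep x \<and> circle_rep x < t} \<union> {to_circle 0})"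
  proof -
    have "0 \<le> circle_rep x" for x
      by transfer (simp add: frac_ge_0)
    moreover have "circle_rep x = 0 \<longleftrightarrow> x = to_circle 0" for x
      by (metis circle_rep_to_circle frac_of_int of_int_0 to_circle_rep)
    ultimately show ?thesis by (auto simp: less_le) (metis order.trans not_le less_le)+
  qed
  moreover from calculation
  have "{x. 0 < circle_rep x \<and> circle_rep x < t} \<union> {to_circle 0} \<in> sets borel"
    by (intro sets.Un borel_open borel_closed)
  ultimately show "{x \<in> space borel. circle_rep x < t} \<in> sets borel"
    by (cases "t \<le> 0") simp_all
qed

section \<open>Integer powers of the rotation\<close>

lemma inv_rotation: "inv (rotation \<theta>) = (\<lambda>x. x + to_circle (- \<theta>))"
  by (rule inv_equality) (auto simp: rotation_def to_circle_minus)

lemma int_iterate_rotation: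
  "int_iterate (rotation \<theta>) k x = x + to_circle (of_int k * \<theta>)"
proof -
  have pow: "((\<lambda>x. x + to_circle r) ^^ n) x = x + to_circle (real n * r)" for r n
    by (induction n) (auto simp: to_circle_0 to_circle_add[symmetric] algebra_simps)
  show ?thesis
    by (cases "0 \<le> k")
       (simp_all add: int_iterate_def inv_rotation pow, simp add: rotation_def[abs_def] pow)
qed

text \<open>The images in the orbit measure become preimages under the inverse translation, which
  preserve measurability and commute with unions.\<close>

lemma int_iterate_rotation_image:
  "int_iterate (rotation \<theta>) k ` A = (\<lambda>x. x + to_circle (- (of_int k * \<theta>))) -` A"
proof -
  have "x = int_iterate (rotation \<theta>) k (x + to_circle (- (of_int k * \<theta>)))" for x
    by (simp add: int_iterate_rotation to_circle_minus)
  then show ?thesis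
    by (force simp: int_iterate_rotation to_circle_minus)
qed

section \<open>Digit sums\<close>

locale digit_sequence =
  fixes b :: "nat \<Rightarrow> real"
  assumes b_first: "\<bar>b 0\<bar> < 1 / 3"
    and b_Suc: "\<bar>b (Suc i)\<bar> < \<bar>b i\<bar> / 3"
begin

definition digit_sum :: "(nat \<Rightarrow> bool) \<Rightarrow> real"
  where "digit_sum x = (\<Sum>i. of_bool (x i) * b i)"

lemma b_nonzero: "b i \<noteq> 0"
  using b_Suc[of i] by auto

lemma b_shift_le: "\<bar>b (i + n)\<bar> \<le> \<bar>b n\<bar> * (1 / 3) ^ i"
proof (induction i)
  case (Suc i)
  then show ?case using b_Suc[of "i + n"] by simp
qed simp

lemma b_le: "\<bar>b i\<bar> \<le> (1 / 3) ^ Suc i"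
proof -
  have "\<bar>b (i + 0)\<bar> \<le> \<bar>b 0\<bar> * (1 / 3) ^ i" by (rule b_shift_le)
  also have "\<dots> \<le> 1 / 3 * (1 / 3) ^ i"
    using b_first by (intro mult_right_mono) auto
  finally show ?thesis by simp
qed

text \<open>Weights bounded by 1 cover both digits and differences of digits. The factor 3/2 is the
  sum of the geometric series of ratio 1/3.\<close>

lemma
  assumes e: "\<And>i. \<bar>e i\<bar> \<le> 1"
  shows summable_weighted: "summable (\<lambda>i. e i * b i)" (is ?summable)
    and weighted_tail_bound: "\<bar>\<Sum>i. e (i + n) * b (i + n)\<bar> \<le> 3 / 2 * \<bar>b n\<bar>" (is ?bound)
proof -
  have le: "\<bar>e (i + n) * b (i + n)\<bar> \<le> \<bar>b n\<bar> * (1 / 3) ^ i" for i n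
    unfolding abs_mult using mult_mono[OF e b_shift_le[of i n]] by simp
  have geom: "(\<lambda>i. \<bar>b n\<bar> * (1 / 3) ^ i) sums (\<bar>b n\<bar> * (1 / (1 - 1 / 3)))" for n
    by (intro sums_mult geometric_sums) simp
  show ?summable
    using summable_comparison_test'[OF sums_summable[OF geom[of 0]], of 0 "\<lambda>i. e i * b i"]
      le[of _ 0] by simp
  have "\<bar>\<Sum>i. e (i + n) * b (i + n)\<bar> \<le> (\<Sum>i. \<bar>b n\<bar> * (1 / 3) ^ i)"
    using norm_suminf_le[of "\<lambda>i. e (i + n) * b (i + n)", OF _ sums_summable[OF geom[of n]]]
      le[of _ n] by simp
  then show ?bound using sums_unique[OF geom[of n]] by simp
qed

lemma summable_digits: "summable (\<lambda>i. of_bool (x i) * b i)"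
  by (rule summable_weighted) auto

lemma digit_sum_diff:
  "digit_sum x - digit_sum y = (\<Sum>i. (of_bool (x i) - of_bool (y i)) * b i)"
  unfolding digit_sum_def left_diff_distrib
  by (rule suminf_diff) (rule summable_digits)+

text \<open>The bound 3/2 times \<open>\<bar>b 0\<bar>\<close> is below 1/2. Hence two digit sums
  that agree modulo 1 are equal as reals.\<close>

lemma abs_digit_sum_diff: "\<bar>digit_sum x - digit_sum y\<bar> < 1"
proof -
  have "\<bar>\<Sum>i. (of_bool (x (i + 0)) - of_bool (y (i + 0))) * b (i + 0)\<bar> \<le> 3 / 2 * \<bar>b 0\<bar>"
    by (rule weighted_tail_bound[of "\<lambda>i. of_bool (x i) - of_bool (y i)"]) auto
  then show ?thesis using b_first by (simp add: digit_sum_diff)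
qed

text \<open>At the first index \<open>n\<close> where the sequences differ, the term of size
  \<open>\<bar>b n\<bar>\<close> cannot be cancelled by the later terms, whose total is less than
  half of it.\<close>

lemma inj_digit_sum: "inj digit_sum"
proof
  fix x y assume eq: "digit_sum x = digit_sum y"
  show "x = y"
  proof (rule ccontr)
    assume "x \<noteq> y"
    then have ex: "\<exists>n. x n \<noteq> y n" by auto
    define n where "n = (LEAST n. x n \<noteq> y n)"
    have n: "x n \<noteq> y n" using LeastI_ex[OF ex] by (simp add: n_def)
    have less: "x i = y i" if "i < n" for i
      using not_less_Least[of i "\<lambda>i. x i \<noteq> y i"] that by (auto simp: n_def)
    define e :: "nat \<Rightarrow> real" where "e i = of_bool (x i) - of_bool (y i)" for i
    have e: "\<bar>e i\<bar> \<le> 1" for i by (auto simp: e_def)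
    have "0 = (\<Sum>i. e i * b i)" using eq digit_sum_diff[of x y] by (simp add: e_def)
    also have "\<dots> = (\<Sum>i. e (i + Suc n) * b (i + Suc n)) + (\<Sum>i<Suc n. e i * b i)"
      by (rule suminf_split_initial_segment) (rule summable_weighted, rule e)
    also have "(\<Sum>i<Suc n. e i * b i) = e n * b n"
      using less by (simp add: e_def)
    finally have "\<bar>e n * b n\<bar> = \<bar>\<Sum>i. e (i + Suc n) * b (i + Suc n)\<bar>" by linarith
    also have "\<dots> \<le> 3 / 2 * \<bar>b (Suc n)\<bar>" by (rule weighted_tail_bound) (rule e)
    also have "\<dots> < \<bar>b n\<bar>" using b_Suc[of n] b_nonzero[of n] by linarith
    finally show False using n by (auto simp: e_def)
  qed
qed

lemma inj_to_circle_digit_sum: "inj (\<lambda>x. to_circle (digit_sum x))"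
proof
  fix x y assume "to_circle (digit_sum x) = to_circle (digit_sum y)"
  then obtain k where k: "digit_sum x - digit_sum y = of_int k"
    by (auto simp: to_circle_eq_iff elim: Ints_cases)
  then have "k = 0" using abs_digit_sum_diff[of x y] by simp
  with k show "x = y" using injD[OF inj_digit_sum, of x y] by simp
qed

lemma measurable_digit_sum:
  assumes "\<And>i. sets (M i) = UNIV"
  shows "digit_sum \<in> borel_measurable (PiM UNIV M)"
proof -
  have "(\<lambda>x. of_bool (x i) :: real) \<in> borel_measurable (PiM UNIV M)" for i
  proof (rule measurable_compose[of "\<lambda>x. x i" _ "M i"])
    show "(\<lambda>y. of_bool y :: real) \<in> borel_measurable (M i)"
      by (intro measurableI) (simp_all add: assms)
  qed auto
  then show ?thesis
    unfolding digit_sum_def[abs_def] by (intro borel_measurable_suminf borel_measurable_times) auto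
qed

text \<open>The centres are the possible sums of the first \<open>n\<close> digits. The radius
  bounds the remaining tail: 3/2 times \<open>(1 / 3) ^ Suc n\<close> equals
  \<open>(1 / 3) ^ n / 2\<close>.\<close>

definition digit_cover :: "real set"
  where "digit_cover = (\<Inter>n. \<Union>W\<in>Pow {..<n}. cball (sum b W) ((1 / 3) ^ n / 2))"

lemma digit_sum_in_cover: "digit_sum x \<in> digit_cover"
  unfolding digit_cover_def
proof
  fix n
  let ?W = "{i. i < n \<and> x i}"
  have "digit_sum x = (\<Sum>i. of_bool (x (i + n)) * b (i + n)) + (\<Sum>i<n. of_bool (x i) * b i)"
    unfolding digit_sum_def by (rule suminf_split_initial_segment) (rule summable_digits)
  moreover have "(\<Sum>i<n. of_bool (x i) * b i) = sum b ?W"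
    by (rule sum.mono_neutral_cong_right) auto
  moreover have "\<bar>\<Sum>i. of_bool (x (i + n)) * b (i + n)\<bar> \<le> 3 / 2 * \<bar>b n\<bar>"
    by (rule weighted_tail_bound[of "\<lambda>i. of_bool (x i)"]) auto
  ultimately have "\<bar>digit_sum x - sum b ?W\<bar> \<le> (1 / 3) ^ n / 2"
    using b_le[of n] by simp
  then have "digit_sum x \<in> cball (sum b ?W) ((1 / 3) ^ n / 2)"
    by (simp add: dist_real_def abs_minus_commute)
  then show "digit_sum x \<in> (\<Union>W\<in>Pow {..<n}. cball (sum b W) ((1 / 3) ^ n / 2))"
    by (rule UN_I[rotated]) auto
qed

lemma compact_digit_cover: "compact digit_cover"
  unfolding compact_eq_bounded_closed
proof
  have "digit_cover \<subseteq> (\<Union>W\<in>Pow {..<0}. cball (sum b W) ((1 / 3) ^ 0 / 2))"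
    unfolding digit_cover_def by blast
  then show "bounded digit_cover" by (rule bounded_subset[rotated]) auto
  show "closed digit_cover"
    unfolding digit_cover_def by (intro closed_INT closed_UN ballI) auto
qed

text \<open>The total length of the intervals at level \<open>n\<close> is at most (2/3)^n, which
  tends to 0.\<close>

lemma digit_cover_null: "digit_cover \<in> null_sets lborel"
proof
  show meas: "digit_cover \<in> sets lborel"
    using compact_digit_cover by (simp add: borel_compact)
  have "emeasure lborel digit_cover \<le> ennreal ((2 / 3) ^ n)" for n
  proof -
    let ?C = "\<lambda>W. cball (sum b W) ((1 / 3) ^ n / 2)"
    have "emeasure lborel digit_cover \<le> emeasure lborel (\<Union>W\<in>Pow {..<n}. ?C W)"
      by (rule emeasure_mono) (auto simp: digit_cover_def)
    also have "\<dots> \<le> (\<Sum>W\<in>Pow {..<n}. emeasure lborel (?C W))"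
      by (rule emeasure_subadditive_finite) auto
    also have "\<dots> = (\<Sum>W\<in>Pow {..<n}. ennreal ((1 / 3) ^ n))"
      by (intro sum.cong refl) (simp add: cball_eq_atLeastAtMost)
    also have "\<dots> = ennreal (\<Sum>W\<in>Pow {..<n}. (1 / 3) ^ n)"
      by (rule sum_ennreal) simp
    also have "(\<Sum>W\<in>Pow {..<n}. (1 / 3 :: real) ^ n) = (2 / 3) ^ n"
      by (simp add: card_Pow power_divide)
    finally show ?thesis .
  qed
  moreover have "(\<lambda>n. ennreal ((2 / 3) ^ n)) \<longlonglongrightarrow> ennreal 0"
    by (intro tendsto_ennrealI LIMSEQ_power_zero) simp
  ultimately have "emeasure lborel digit_cover \<le> 0"
    by (intro LIMSEQ_le_const[of "\<lambda>n. ennreal ((2 / 3) ^ n)"]) auto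
  then show "emeasure lborel digit_cover = 0" by simp
qed

end

section \<open>The orbit measure\<close>

text \<open>The one-step equivalence is used forwards for positive \<open>k\<close> and backwards
  for negative \<open>k\<close>.\<close>

lemma rotation_invariant_orbit:
  assumes "rotation \<theta> -` A = A"
  shows "x + to_circle (of_int k * \<theta>) \<in> A \<longleftrightarrow> x \<in> A"
proof -
  have step: "y + to_circle \<theta> \<in> A \<longleftrightarrow> y \<in> A" for y
    using assms by (auto simp: rotation_def)
  show ?thesis
  proof (induction k arbitrary: x rule: int_induct[where k = 0])
    case base
    then show ?case by (simp add: to_circle_0)
  next
    case (step1 i)
    have "x + to_circle (of_int (i + 1) * \<theta>) = (x + to_circle (of_int i * \<theta>)) + to_circle \<theta>"
      by (simp add: distrib_right to_circle_add add.assoc)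
    then show ?case by (simp only: step step1.IH)
  next
    case (step2 i)
    have "x + to_circle (of_int i * \<theta>) = (x + to_circle (of_int (i - 1) * \<theta>)) + to_circle \<theta>"
      by (simp add: left_diff_distrib add.assoc flip: to_circle_add)
    then show ?case using step2.IH[of x] step[of "x + to_circle (of_int (i - 1) * \<theta>)"]
      by (simp only:)
  qed
qed

text \<open>The number \<open>q\<close> bounds the probability of either value of every digit, so a
  cylinder fixing \<open>n\<close> digits has mass at most q^n.\<close>

locale digit_orbit =
  fixes \<theta> :: real and m :: "nat \<Rightarrow> nat" and a :: "nat \<Rightarrow> real" and q :: real
  assumes first_digit: "\<bar>signed_rep (real (m 0) * \<theta>)\<bar> < 1 / 3"
    and next_digit: "\<And>i. \<bar>signed_rep (real (m (Suc i)) * \<theta>)\<bar> < \<bar>signed_rep (real (m i) * \<theta>)\<bar> / 3"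
    and mass: "\<And>i. 0 < a i" "\<And>i. a i < 1" "\<And>i. a i \<le> q" "\<And>i. 1 - a i \<le> q"
    and q_less_1: "q < 1"
begin

sublocale digit_sequence "\<lambda>i. signed_rep (real (m i) * \<theta>)"
  by unfold_locales (fact first_digit, fact next_digit)

abbreviation "\<nu> \<equiv> orbit_measure \<theta> m a"
abbreviation "\<nu>0 \<equiv> circle_digit_measure \<theta> m a"

text \<open>The inverse of the k-th power of the rotation: the preimage of \<open>A\<close> under
  \<open>translate k\<close> is the k-th rotated image of \<open>A\<close>.\<close>

definition translate :: "int \<Rightarrow> circle \<Rightarrow> circle"
  where "translate k x = x + to_circle (- (of_int k * \<theta>))"

definition weight :: "int \<Rightarrow> ennreal"
  where "weight k = ennreal ((sqrt 2 - 1) ^ (1 + nat \<bar>k\<bar>))"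

lemma digit_map_eq: "digit_map \<theta> m x = to_circle (digit_sum x)"
  by (simp add: digit_map_def digit_sum_def)

section \<open>The law of the digits and its image on the circle\<close>

lemma prob_space_digit_measure: "prob_space (digit_measure a)"
  unfolding digit_measure_def by (rule prob_space_PiM) (rule prob_space_measure_pmf)

lemma space_digit_measure: "space (digit_measure a) = UNIV"
  by (simp add: digit_measure_def space_PiM)

lemma measurable_digit_map: "digit_map \<theta> m \<in> borel_measurable (digit_measure a)"
  unfolding digit_map_eq[abs_def] digit_measure_def
  by (intro measurable_compose[OF measurable_digit_sum measurable_to_circle]) simp

lemma prob_space_\<nu>0: "prob_space \<nu>0"
  unfolding circle_digit_measure_def
  by (rule prob_space.prob_space_distr[OF prob_space_digit_measure measurable_digit_map])

lemma sets_\<nu>0: "sets \<nu>0 = sets borel" and space_\<nu>0: "space \<nu>0 = UNIV"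
  by (simp_all add: circle_digit_measure_def)

lemma emeasure_\<nu>0:
  "A \<in> sets borel \<Longrightarrow> emeasure \<nu>0 A = emeasure (digit_measure a) (digit_map \<theta> m -` A)"
  unfolding circle_digit_measure_def
  using measurable_digit_map by (simp add: emeasure_distr space_digit_measure)

text \<open>For every \<open>n\<close> the set lies in the cylinder that fixes the first
  \<open>n\<close> digits of \<open>x\<close>, of mass at most q^n. Preimages of points under the
  injective digit map have exactly this form, possibly empty.\<close>

lemma emeasure_digit_measure_subsingleton:
  assumes "X \<in> sets (digit_measure a)" "X \<subseteq> {x}"
  shows "emeasure (digit_measure a) X = 0"
proof -
  let ?M = "\<lambda>i. measure_pmf (bernoulli_pmf (1 - a i))"
  have "emeasure (digit_measure a) X \<le> ennreal (q ^ n)" for n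
  proof -
    let ?E = "prod_emb UNIV ?M {..<n} (\<Pi>\<^sub>E i\<in>{..<n}. {x i})"
    have "emeasure (digit_measure a) X \<le> emeasure (digit_measure a) ?E"
      unfolding digit_measure_def
    proof (rule emeasure_mono)
      show "X \<subseteq> ?E" using assms(2) by (auto simp: prod_emb_def)
      show "?E \<in> sets (PiM UNIV ?M)" by (rule sets_PiM_I) auto
    qed
    also have "\<dots> = (\<Prod>i<n. emeasure (?M i) {x i})"
      unfolding digit_measure_def
      by (rule emeasure_PiM_emb) (auto intro: prob_space_measure_pmf)
    also have "\<dots> \<le> (\<Prod>i<n. ennreal q)"
    proof (rule prod_mono_ennreal)
      fix i
      show "emeasure (?M i) {x i} \<le> ennreal q"
        using mass[of i] by (cases "x i") (auto simp: emeasure_pmf_single intro!: ennreal_leI)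
    qed
    also have "\<dots> = ennreal (q ^ n)"
      using mass[of 0] by (simp add: ennreal_power)
    finally show ?thesis .
  qed
  moreover have "(\<lambda>n. ennreal (q ^ n)) \<longlonglongrightarrow> ennreal 0"
    using mass[of 0] q_less_1 by (intro tendsto_ennrealI LIMSEQ_power_zero) auto
  ultimately have "emeasure (digit_measure a) X \<le> 0"
    by (intro LIMSEQ_le_const[of "\<lambda>n. ennreal (q ^ n)"]) auto
  then show ?thesis by simp
qed

lemma emeasure_\<nu>0_subsingleton:
  assumes "A \<in> sets borel" "A \<subseteq> {c}"
  shows "emeasure \<nu>0 A = 0"
proof -
  have "digit_map \<theta> m -` A \<in> sets (digit_measure a)"
    using measurable_sets[OF measurable_digit_map assms(1)] by (simp add: space_digit_measure)
  moreover obtain x where "digit_map \<theta> m -` A \<subseteq> {x}"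
  proof (cases "digit_map \<theta> m -` A = {}")
    case False
    then obtain x where "digit_map \<theta> m x = c" using assms(2) by blast
    then have "digit_map \<theta> m -` A \<subseteq> digit_map \<theta> m -` {digit_map \<theta> m x}"
      using assms(2) by blast
    also have "\<dots> \<subseteq> {x}"
      unfolding digit_map_eq by (auto dest: injD[OF inj_to_circle_digit_sum])
    finally show ?thesis by (rule that)
  qed (use that in simp)
  ultimately show ?thesis
    using emeasure_digit_measure_subsingleton assms(1) by (auto simp: emeasure_\<nu>0)
qed

section \<open>Values, total mass and null sets of the orbit measure\<close>

lemma translate_rotation: "translate k (rotation \<theta> x) = translate (k - 1) x"
  by (simp add: translate_def rotation_def add.assoc left_diff_distrib flip: to_circle_add)

lemma measurable_translate [measurable]: "translate k \<in> borel_measurable borel"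
  unfolding translate_def[abs_def] by measurable

lemma translate_vimage_borel: "A \<in> sets borel \<Longrightarrow> translate k -` A \<in> sets borel"
  using measurable_sets[OF measurable_translate] by simp

lemma sets_\<nu>: "sets \<nu> = sets borel" and space_\<nu>: "space \<nu> = UNIV"
  unfolding orbit_measure_def using sets.sigma_sets_eq[of "borel :: circle measure"]
  by (simp_all add: sets_measure_of space_measure_of)

lemma emeasure_\<nu>:
  assumes "A \<in> sets borel"
  shows "emeasure \<nu> A = (\<integral>\<^sup>+k. weight k * emeasure \<nu>0 (translate k -` A) \<partial>count_space UNIV)"
proof -
  let ?f = "\<lambda>A. \<integral>\<^sup>+k. weight k * emeasure \<nu>0 (translate k -` A) \<partial>count_space UNIV"
  have eq: "\<nu> = measure_of UNIV (sets borel) ?f"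
    unfolding orbit_measure_def infsum_int_eq_nn_integral
    by (simp add: int_iterate_rotation_image weight_def translate_def[abs_def])
  \<comment> \<open>\<open>measure_of\<close> takes the prescribed values only once they are known
    to form a measure. Additivity holds for each \<open>k\<close> and passes through the integral by
    exchanging it with the series.\<close>
  have "countably_additive (sets borel) ?f"
  proof (rule countably_additiveI)
    fix B :: "nat \<Rightarrow> circle set"
    assume B: "range B \<subseteq> sets borel" "disjoint_family B"
    have "(\<Sum>i. ?f (B i)) =
        (\<integral>\<^sup>+k. (\<Sum>i. weight k * emeasure \<nu>0 (translate k -` B i)) \<partial>count_space UNIV)"
      by (rule nn_integral_suminf[symmetric]) simp
    also have "\<dots> = ?f (\<Union> (range B))"
    proof (rule nn_integral_cong)
      fix k
      have "(\<Sum>i. emeasure \<nu>0 (translate k -` B i)) = emeasure \<nu>0 (\<Union>i. translate k -` B i)"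
        using B by (intro suminf_emeasure)
          (auto simp: disjoint_family_on_def sets_\<nu>0 intro: translate_vimage_borel)
      then show "(\<Sum>i. weight k * emeasure \<nu>0 (translate k -` B i)) =
          weight k * emeasure \<nu>0 (translate k -` \<Union> (range B))"
        by (simp add: vimage_UN)
    qed
    finally show "(\<Sum>i. ?f (B i)) = ?f (\<Union> (range B))" .
  qed
  then show ?thesis
    by (intro emeasure_measure_of[OF eq]) (auto simp: assms positive_def sets_\<nu>)
qed

text \<open>The constant sqrt 2 - 1 is the positive root of g (1 + g) = 1 - g, which normalises the
  two-sided geometric sum to 1.\<close>

lemma nn_integral_weight: "(\<integral>\<^sup>+k. weight k \<partial>count_space UNIV) = 1"
proof -
  have "(sqrt 2 - 1) * (1 + (sqrt 2 - 1)) / (1 - (sqrt 2 - 1)) = (1 :: real)"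
    using sqrt2_less_2 by (simp add: field_simps)
  moreover have "sqrt 2 - 1 < (1 :: real)" using sqrt2_less_2 by simp
  ultimately show ?thesis
    using infsum_two_sided_geometric[of "sqrt 2 - 1"]
    by (simp add: weight_def flip: infsum_int_eq_nn_integral)
qed

lemma prob_space_\<nu>: "prob_space \<nu>"
proof
  interpret \<nu>0: prob_space \<nu>0 by (rule prob_space_\<nu>0)
  show "emeasure \<nu> (space \<nu>) = 1"
    using \<nu>0.emeasure_space_1
    by (simp add: space_\<nu> space_\<nu>0 emeasure_\<nu> nn_integral_weight)
qed

text \<open>All weights are strictly positive, so the sum vanishes only if every term does.\<close>

lemma emeasure_\<nu>_eq_0_iff:
  assumes "A \<in> sets borel"
  shows "emeasure \<nu> A = 0 \<longleftrightarrow> (\<forall>k. emeasure \<nu>0 (translate k -` A) = 0)"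
proof -
  have "weight k \<noteq> 0" for k
    by (simp add: weight_def ennreal_eq_0_iff not_le)
  then show ?thesis
    by (simp add: emeasure_\<nu>[OF assms] nn_integral_0_iff_AE AE_count_space)
qed

text \<open>Every translate of an invariant set is the set itself, so the weighted average is an
  average of equal terms.\<close>

lemma emeasure_\<nu>_invariant:
  assumes A: "A \<in> sets borel" and inv: "rotation \<theta> -` A = A"
  shows "emeasure \<nu> A = emeasure \<nu>0 A"
proof -
  have "translate k x \<in> A \<longleftrightarrow> x \<in> A" for k x
    using rotation_invariant_orbit[OF inv, of x "- k"] by (simp add: translate_def)
  then have "translate k -` A = A" for k by blast
  then show ?thesis
    by (simp add: emeasure_\<nu>[OF A] nn_integral_multc nn_integral_weight)
qed

section \<open>Ergodicity\<close>

lemma digit_map_finite_change: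
  assumes "finite {i. x i \<noteq> y i}"
  shows "\<exists>k. digit_map \<theta> m y = digit_map \<theta> m x + to_circle (of_int k * \<theta>)"
proof -
  let ?F = "{i. x i \<noteq> y i}"
  define e :: "nat \<Rightarrow> int" where "e i = of_bool (y i) - of_bool (x i)" for i
  define l where "l i = \<lceil>real (m i) * \<theta> - 1 / 2\<rceil>" for i
  have l: "signed_rep (real (m i) * \<theta>) = real (m i) * \<theta> - of_int (l i)" for i
    by (simp add: signed_rep_def l_def)
  \<comment> \<open>Each signed representative is \<open>real (m i) * \<theta>\<close> minus the
    integer \<open>l i\<close>. Summed with signs over the changed digits, the first parts give the
    multiple \<open>k\<close> of \<theta> and the second the integer \<open>j\<close>, which
    vanishes on the circle.\<close>
  define k j where "k = (\<Sum>i\<in>?F. e i * int (m i))" and "j = (\<Sum>i\<in>?F. e i * l i)"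
  have "digit_sum y - digit_sum x = (\<Sum>i. of_int (e i) * signed_rep (real (m i) * \<theta>))"
    unfolding digit_sum_diff e_def by simp
  also have "\<dots> = (\<Sum>i\<in>?F. of_int (e i) * signed_rep (real (m i) * \<theta>))"
    by (rule suminf_finite) (use assms in \<open>auto simp: e_def\<close>)
  also have "\<dots> = of_int k * \<theta> - of_int j"
    unfolding l k_def j_def
    by (simp add: sum_distrib_right sum_subtractf right_diff_distrib mult.assoc)
  finally have "digit_sum y - (digit_sum x + of_int k * \<theta>) = - of_int j" by simp
  then have "to_circle (digit_sum y) = to_circle (digit_sum x + of_int k * \<theta>)"
    unfolding to_circle_eq_iff by simp
  then show ?thesis by (auto simp: digit_map_eq to_circle_add)
qed

lemma ergodic_\<nu>: "ergodic (rotation \<theta>) \<nu>"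
  unfolding ergodic_def
proof (intro ballI impI)
  fix A assume "A \<in> sets \<nu>" and "rotation \<theta> -` A \<inter> space \<nu> = A"
  then have A: "A \<in> sets borel" and inv: "rotation \<theta> -` A = A"
    by (simp_all add: sets_\<nu> space_\<nu>)
  let ?X = "digit_map \<theta> m -` A"
  have "?X \<in> sets (digit_measure a)"
    using measurable_sets[OF measurable_digit_map A] by (simp add: space_digit_measure)
  moreover have "y \<in> ?X" if "finite {i. x i \<noteq> y i}" "x \<in> ?X" for x y
    using digit_map_finite_change[OF that(1)] that(2) rotation_invariant_orbit[OF inv]
    by auto
  ultimately have "emeasure (digit_measure a) ?X = 0 \<or> emeasure (digit_measure a) ?X = 1"
    unfolding digit_measure_def
    by (intro PiM_zero_one_law) (auto intro: prob_space_measure_pmf)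
  then show "emeasure \<nu> A = 0 \<or> emeasure \<nu> A = 1"
    by (simp add: emeasure_\<nu>_invariant[OF A inv] emeasure_\<nu>0[OF A])
qed

section \<open>Quasi-invariance\<close>

lemma quasi_invariant_\<nu>: "quasi_invariant (rotation \<theta>) \<nu>"
proof -
  have rot: "rotation \<theta> = translate (- 1)"
    by (auto simp: rotation_def translate_def)
  then have meas: "rotation \<theta> \<in> measurable \<nu> \<nu>"
    using measurable_translate by (simp cong: measurable_cong_sets add: sets_\<nu>)
  have "emeasure \<nu> A = 0 \<longleftrightarrow> emeasure (distr \<nu> \<nu> (rotation \<theta>)) A = 0" if "A \<in> sets borel" for A
  proof -
    \<comment> \<open>Pulling back along the rotation only shifts the index, and the null-set
      criterion ranges over all integers.\<close>
    have "translate k -` (translate (- 1) -` A) = translate (k - 1) -` A" for k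
      using translate_rotation unfolding rot by (auto simp: translate_def add_ac)
    then have "emeasure \<nu> (rotation \<theta> -` A) = 0 \<longleftrightarrow> (\<forall>k. emeasure \<nu>0 (translate (k - 1) -` A) = 0)"
      using that by (simp add: rot emeasure_\<nu>_eq_0_iff translate_vimage_borel)
    also have "\<dots> \<longleftrightarrow> (\<forall>k. emeasure \<nu>0 (translate k -` A) = 0)"
      by (metis add_diff_cancel_right')
    finally show ?thesis
      using that meas by (simp add: emeasure_distr sets_\<nu> space_\<nu> emeasure_\<nu>_eq_0_iff)
  qed
  then show ?thesis
    by (auto simp: quasi_invariant_def null_sets_def sets_\<nu>)
qed

section \<open>Absence of atoms\<close>

lemma nonatomic_\<nu>: "nonatomic \<nu>"
proof (rule nonatomic_if_null_fibres)
  show "finite_measure \<nu>" using prob_space_\<nu> by (rule prob_space.finite_measure)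
  show "circle_rep \<in> borel_measurable \<nu>"
    using measurable_circle_rep by (simp cong: measurable_cong_sets add: sets_\<nu>)
  fix t
  have "circle_rep -` {t} \<in> sets borel"
    using measurable_sets[OF measurable_circle_rep, of "{t}"] by simp
  \<comment> \<open>Both the coordinate and the translation are injective, so a fibre pulls back to
    at most one point, which is null for \<open>\<nu>0\<close>.\<close>
  moreover have "translate k -` (circle_rep -` {t}) \<subseteq> {to_circle t + to_circle (of_int k * \<theta>)}" for k
  proof
    fix x assume "x \<in> translate k -` (circle_rep -` {t})"
    then have "translate k x = to_circle t" using to_circle_rep[of "translate k x"] by simp
    then show "x \<in> {to_circle t + to_circle (of_int k * \<theta>)}"
      by (simp add: translate_def to_circle_minus algebra_simps)
  qed
  ultimately show "emeasure \<nu> (circle_rep -` {t} \<inter> space \<nu>) = 0"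
    by (simp add: space_\<nu> emeasure_\<nu>_eq_0_iff)
       (blast intro: emeasure_\<nu>0_subsingleton translate_vimage_borel)
qed

section \<open>Singularity to Lebesgue measure\<close>

definition support_orbit :: "circle set"
  where "support_orbit = (\<Union>k. translate k -` (to_circle ` digit_cover))"

lemma support_orbit_borel: "support_orbit \<in> sets borel"
  unfolding support_orbit_def
  using closed_to_circle_image[OF compact_digit_cover]
  by (intro sets.countable_UN) (intro image_subsetI translate_vimage_borel borel_closed)

text \<open>This is the reason for taking the union over the whole orbit: on an invariant set
  \<open>\<nu>\<close> can be computed from \<open>\<nu>0\<close> alone.\<close>

lemma support_orbit_invariant: "rotation \<theta> -` support_orbit = support_orbit"
proof -
  have "rotation \<theta> -` support_orbit = (\<Union>k. translate (k - 1) -` (to_circle ` digit_cover))"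
    unfolding support_orbit_def vimage_UN by (simp add: vimage_def translate_rotation)
  also have "\<dots> = (\<Union>k\<in>range (\<lambda>k. k - 1). translate k -` (to_circle ` digit_cover))"
    by (simp only: image_image)
  also have "range (\<lambda>k::int. k - 1) = UNIV"
    by (rule surjI[of _ "\<lambda>k. k + 1"]) simp
  finally show ?thesis by (simp add: support_orbit_def)
qed

text \<open>Upstairs the set is a countable union of translates of \<open>digit_cover\<close>, by
  the numbers k \<theta> + j with integers k and j.\<close>

lemma support_orbit_lebesgue_null: "to_circle -` support_orbit \<in> null_sets lborel"
proof -
  have "to_circle -` support_orbit =
      (\<Union>k::int. \<Union>j::int. {y. y - (of_int k * \<theta> + of_int j) \<in> digit_cover})"
  proof (intro set_eqI iffI)
    fix y assume "y \<in> to_circle -` support_orbit"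
    then obtain k z where z: "z \<in> digit_cover" and "translate k (to_circle y) = to_circle z"
      by (auto simp: support_orbit_def)
    then have "to_circle (y - of_int k * \<theta>) = to_circle z"
      by (simp add: translate_def flip: to_circle_add)
    then obtain j where "y - of_int k * \<theta> - z = of_int j"
      by (auto simp: to_circle_eq_iff elim: Ints_cases)
    then have "y - (of_int k * \<theta> + of_int j) = z" by simp
    with z show "y \<in> (\<Union>k::int. \<Union>j::int. {y. y - (of_int k * \<theta> + of_int j) \<in> digit_cover})"
      by blast
  next
    fix y assume "y \<in> (\<Union>k::int. \<Union>j::int. {y. y - (of_int k * \<theta> + of_int j) \<in> digit_cover})"
    then obtain k j :: int where z: "y - (of_int k * \<theta> + of_int j) \<in> digit_cover" by blast
    have "translate k (to_circle y) = to_circle (y - (of_int k * \<theta> + of_int j))"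
      by (simp add: translate_def to_circle_eq_iff flip: to_circle_add)
    with z show "y \<in> to_circle -` support_orbit"
      unfolding support_orbit_def by blast
  qed
  also have "\<dots> \<in> null_sets lborel"
    by (intro null_sets_UN null_sets_translation digit_cover_null)
  finally show ?thesis .
qed

lemma singular_\<nu>: "mutually_singular \<nu> lebesgue_circle"
  unfolding mutually_singular_def
proof (intro bexI conjI)
  \<comment> \<open>The separating set is the complement of \<open>support_orbit\<close>. The piece
    k = 0 already contains every value of the digit map, so this complement is null for
    \<open>\<nu>0\<close> and, by invariance, for \<open>\<nu>\<close>.\<close>
  have "digit_map \<theta> m x \<in> support_orbit" for x
  proof -
    have "translate 0 (digit_map \<theta> m x) \<in> to_circle ` digit_cover"
      using digit_sum_in_cover by (simp add: translate_def to_circle_0 digit_map_eq)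
    then show ?thesis unfolding support_orbit_def by blast
  qed
  then have "digit_map \<theta> m -` (- support_orbit) = {}" by auto
  moreover have compl: "- support_orbit \<in> sets borel"
    using support_orbit_borel by (rule borel_comp)
  moreover have "rotation \<theta> -` (- support_orbit) = - support_orbit"
    using support_orbit_invariant by auto
  ultimately show "emeasure \<nu> (- support_orbit) = 0"
    by (simp add: emeasure_\<nu>_invariant emeasure_\<nu>0)
  show "- support_orbit \<in> sets \<nu> \<inter> sets lebesgue_circle"
    using compl by (simp add: sets_\<nu> lebesgue_circle_def)
  have "to_circle \<in> borel_measurable (restrict_space lborel {0..<1})"
    by (rule measurable_restrict_space1) simp
  then have "emeasure lebesgue_circle support_orbit =
      emeasure (restrict_space lborel {0..<1}) (to_circle -` support_orbit \<inter> {0..<1})"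
    using support_orbit_borel unfolding lebesgue_circle_def
    by (simp add: emeasure_distr space_restrict_space)
  also have "\<dots> = emeasure lborel (to_circle -` support_orbit \<inter> {0..<1})"
    by (simp add: emeasure_restrict_space)
  also have "\<dots> = 0"
    using support_orbit_lebesgue_null by (intro null_setsD1 null_set_Int2) simp_all
  finally show "emeasure lebesgue_circle (space lebesgue_circle - - support_orbit) = 0"
    by (simp add: lebesgue_circle_def Diff_eq)
qed

end

theorem proposition5p4:
  fixes \<theta> :: real and m :: "nat \<Rightarrow> nat" and a :: "nat \<Rightarrow> real"
  assumes "0 < \<theta>" and "\<theta> < 1" and "\<theta> \<notin> \<rat>"
    and "strict_mono m"
    and "\<bar>signed_rep (real (m 0) * \<theta>)\<bar> < 1 / 3"
    and "\<And>i. \<bar>signed_rep (real (m (Suc i)) * \<theta>)\<bar> < \<bar>signed_rep (real (m i) * \<theta>)\<bar> / 3"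
    and "\<And>i. 0 < a i \<and> a i < 1"
    and "0 < (INF i. a i)" and "(SUP i. a i) < 1"
  shows "prob_space (orbit_measure \<theta> m a)
    \<and> sets (orbit_measure \<theta> m a) = sets borel
    \<and> ergodic (rotation \<theta>) (orbit_measure \<theta> m a)
    \<and> quasi_invariant (rotation \<theta>) (orbit_measure \<theta> m a)
    \<and> singular_continuous (orbit_measure \<theta> m a)"
proof -
  have "bdd_below (range a)" "bdd_above (range a)"
    using assms(7) by (auto intro!: bdd_belowI[of _ 0] bdd_aboveI[of _ 1] intro: less_imp_le)
  then have "(INF i. a i) \<le> a i" "a i \<le> (SUP i. a i)" for i
    by (auto intro: cINF_lower cSUP_upper)
  note bounds = this
  \<comment> \<open>The upper bound on the sequence controls the probability of digit 0, the lower
    bound that of digit 1; their maximum stays below 1.\<close>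
  interpret digit_orbit \<theta> m a "max (SUP i. a i) (1 - (INF i. a i))"
  proof
    fix i
    show "a i \<le> max (SUP i. a i) (1 - (INF i. a i))"
      using bounds(2)[of i] by linarith
    show "1 - a i \<le> max (SUP i. a i) (1 - (INF i. a i))"
      using bounds(1)[of i] by linarith
  qed (use assms in auto)
  show ?thesis
    unfolding singular_continuous_def
    using prob_space_\<nu> sets_\<nu> ergodic_\<nu> quasi_invariant_\<nu> nonatomic_\<nu> singular_\<nu> by blast
qed

end
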